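(* Let $G$ be a simple connected graph with $n$ vertices. Then $$\min_{u\in V(G)}\{\operatorname{trs}(u)-\deg(u)\}\ \le\ \lambda_1(A^{\operatorname{trs}})\ \le\ \frac1n\sum_{u\in V(G)}(\operatorname{trs}(u)-\deg(u)).$$
   Context: $\deg(u)$ is the degree of $u$ and $\operatorname{trs}(u)=\sum_{v\in V(G)}\operatorname{dist}(u,v)$ its transmission, where $\operatorname{dist}(u,v)$ is the number of edges in a shortest path between $u$ and $v$. $A^{\operatorname{trs}}=A^{\operatorname{trs}}(G)=\operatorname{trs}(G)-A(G)$, where $A(G)$ is the adjacency matrix and $\operatorname{trs}(G)$ the diagonal matrix of transmissions. For a real symmetric $n\times n$ matrix $M$, $\lambda_1(M)\le\lambda_2(M)\le\cdots\le\lambda_n(M)$ denote its eigenvalues. *)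

theory Defs
  imports
    "Graph_Theory.Digraph_Component"
    "Graph_Theory.Shortest_Path"
    "Jordan_Normal_Form.Char_Poly"
begin

text \<open>
  Simple graphs are the instances of the locale \<^locale>\<open>graph\<close>: finite symmetric digraphs without
  loops and parallel arcs. Each edge \<open>uv\<close> is represented by the two arcs from \<open>u\<close> to \<open>v\<close> and
  from \<open>v\<close> to \<open>u\<close>, so the degree of a vertex is its \<^const>\<open>out_degree\<close>. The vertex set may be an
  arbitrary subset of the vertex type.
\<close>

text \<open>In a connected graph the set of path lengths is nonempty, so \<open>LEAST\<close> is well defined.\<close>

definition graph_dist :: "('a, 'b) pre_digraph \<Rightarrow> 'a \<Rightarrow> 'a \<Rightarrow> nat" where
  "graph_dist G u v = (LEAST k. \<exists>p. pre_digraph.apath G u p v \<and> length p = k)"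

lemma (in fin_digraph) graph_dist_conv_\<mu>:
  assumes "u \<rightarrow>\<^sup>* v"
  shows "\<mu> (\<lambda>_. 1) u v = ereal (real (graph_dist G u v))"
proof -
  have cost: "awalk_cost (\<lambda>_. 1) p = real (length p)" for p
    by (simp add: awalk_cost_def sum_list_triv)
  obtain p where p: "apath u p v" "\<mu> (\<lambda>_. 1) u v = awalk_cost (\<lambda>_. 1) p"
    using min_cost_awalk[OF assms, of "\<lambda>_. 1"] by auto
  have "length p \<le> length q" if "apath u q v" for q
    using min_cost_le_walk_cost[OF awalkI_apath[OF that], of "\<lambda>_. 1"] p(2) by (simp add: cost)
  then have "graph_dist G u v = length p"
    unfolding graph_dist_def using p(1) by (intro Least_equality) auto
  with p(2) show ?thesis by (simp add: cost)
qed

definition trs :: "('a, 'b) pre_digraph \<Rightarrow> 'a \<Rightarrow> nat" where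
  "trs G u = (\<Sum>v\<in>verts G. graph_dist G u v)"

text \<open>
  The matrices below are taken with respect to an enumeration \<open>vs\<close> of the vertices: row and column
  \<open>i\<close> belong to the vertex \<open>vs ! i\<close>.
\<close>

definition adj_mat :: "('a, 'b) pre_digraph \<Rightarrow> 'a list \<Rightarrow> real mat" where
  "adj_mat G vs =
     mat (length vs) (length vs) (\<lambda>(i, j). if vs ! i \<rightarrow>\<^bsub>G\<^esub> vs ! j then 1 else 0)"

definition trs_mat :: "('a, 'b) pre_digraph \<Rightarrow> 'a list \<Rightarrow> real mat" where
  "trs_mat G vs = mat_diag (length vs) (\<lambda>i. real (trs G (vs ! i)))"

definition atrs_mat :: "('a, 'b) pre_digraph \<Rightarrow> 'a list \<Rightarrow> real mat" where
  "atrs_mat G vs = trs_mat G vs - adj_mat G vs"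

text \<open>
  The \<open>k\<close>-th smallest eigenvalue, \<open>1 \<le> k \<le> n\<close>, counted with multiplicity. It is meant for real
  symmetric \<open>n \<times> n\<close> matrices, whose characteristic polynomials have \<open>n\<close> real roots.
\<close>

definition eigenvalues_sorted :: "real mat \<Rightarrow> real list" where
  "eigenvalues_sorted M = sorted_list_of_multiset (proots (char_poly M))"

definition nth_eigenvalue :: "nat \<Rightarrow> real mat \<Rightarrow> real" where
  "nth_eigenvalue k M = eigenvalues_sorted M ! (k - 1)"

lemma set_eigenvalues_sorted:
  assumes "M \<in> carrier_mat n n"
  shows "set (eigenvalues_sorted M) = {x. eigenvalue M x}"
proof -
  have "char_poly M \<noteq> 0"
    using degree_monic_char_poly[OF assms] by auto
  then show ?thesis
    by (simp add: eigenvalues_sorted_def eigenvalue_root_char_poly[OF assms])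
qed

end

theory Submission
  imports Defs "HOL-Analysis.Function_Topology"
begin

text \<open>
  The row sum of \<open>A\<^sup>t\<^sup>r\<^sup>s = trs(G) - A(G)\<close> at a vertex \<open>u\<close> is \<open>trs(u) - deg(u)\<close>
  (\<open>atrs_mat_row_sum\<close>), so both bounds compare the least eigenvalue with the row sums.

  The upper bound holds for every real symmetric matrix: the least eigenvalue is at most the
  Rayleigh quotient of the all-ones vector, and this quotient is the average of the row sums. The
  underlying variational principle is \<open>symmetric_eigenvector_minimizing_quadratic_form\<close>: the
  quadratic form attains its minimum on the unit sphere by compactness, and the first-order
  condition at a minimizer says that it is an eigenvector for the minimum value. This also supplies
  a real eigenvalue to begin with, so that the least one exists.

  The lower bound holds because the off-diagonal entries are nonpositive: scale an eigenvector so
  that an entry of largest modulus is positive. In the row of that entry, replacing all entries of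
  the vector by the extremal one can only lower the value of the row, hence every eigenvalue is at
  least the sum of that row (\<open>eigenvalue_ge_some_row_sum\<close>).
\<close>

section \<open>The least eigenvalue of a real symmetric matrix\<close>

lemma linear_coeff_eq_0_if_quadratic_nonneg:
  fixes b c :: real
  assumes nonneg: "\<And>t. 0 \<le> 2 * t * b + t\<^sup>2 * c"
  shows "b = 0"
proof (rule ccontr)
  assume "b \<noteq> 0"
  define d where "d = \<bar>c\<bar> + 1"
  have d: "d > 0" "c < d" by (auto simp: d_def)
  \<comment> \<open>For \<open>c > 0\<close> the minimum of \<open>2 t b + t\<^sup>2 c\<close> is at \<open>t = - b / c\<close>; enlarging \<open>c\<close> to \<open>d\<close> keeps the
    denominator positive whatever the sign of \<open>c\<close>.\<close>
  have "0 \<le> 2 * (- b / d) * b + (- b / d)\<^sup>2 * c" by (rule nonneg)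
  also have "\<dots> = b\<^sup>2 / d\<^sup>2 * (c - 2 * d)"
    using d by (simp add: field_simps power2_eq_square)
  also have "\<dots> < 0"
    using d \<open>b \<noteq> 0\<close> by (intro mult_pos_neg) auto
  finally show False by simp
qed

text \<open>
  Vectors indexed by \<open>I\<close> are functions on the whole index type that vanish outside \<open>I\<close>. In the
  product topology these functions with entries in \<open>[-1, 1]\<close> form a compact set by Tychonoff's
  theorem, and the unit sphere is a closed subset of it; a continuous function attains its minimum
  there.
\<close>

lemma exists_unit_minimizer:
  fixes q :: "('i \<Rightarrow> real) \<Rightarrow> real"
  assumes "finite I" and "I \<noteq> {}" and "continuous_on UNIV q"
  obtains x where "(\<Sum>i\<in>I. (x i)\<^sup>2) = 1" and "\<And>i. i \<notin> I \<Longrightarrow> x i = 0"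
    and "\<And>y. (\<Sum>i\<in>I. (y i)\<^sup>2) = 1 \<Longrightarrow> (\<And>i. i \<notin> I \<Longrightarrow> y i = 0) \<Longrightarrow> q x \<le> q y"
proof -
  define K where "K = (\<Pi>\<^sub>E i\<in>UNIV. if i \<in> I then {-1..1} else {0::real})"
  define S where "S = K \<inter> {x. (\<Sum>i\<in>I. (x i)\<^sup>2) = 1}"
  have "compactin (product_topology (\<lambda>_. euclidean) UNIV) K"
    unfolding K_def by (subst compactin_PiE) auto
  then have "compact K" by (simp add: euclidean_product_topology)
  moreover have "closed {x :: 'i \<Rightarrow> real. (\<Sum>i\<in>I. (x i)\<^sup>2) = 1}"
    by (intro closed_Collect_eq continuous_intros continuous_on_product_coordinates)
  ultimately have "compact S" unfolding S_def by (rule compact_Int_closed)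
  have S_iff: "x \<in> S \<longleftrightarrow> (\<Sum>i\<in>I. (x i)\<^sup>2) = 1 \<and> (\<forall>i. i \<notin> I \<longrightarrow> x i = 0)" for x
  proof -
    have "\<bar>x i\<bar> \<le> 1" if "(\<Sum>i\<in>I. (x i)\<^sup>2) = 1" "i \<in> I" for i
      using member_le_sum[of i I "\<lambda>i. (x i)\<^sup>2"] that assms(1)
      by (simp add: abs_square_le_1)
    then show ?thesis
      unfolding S_def K_def by (force simp: PiE_iff abs_le_iff split: if_splits)
  qed
  \<comment> \<open>A standard basis vector shows that the sphere is nonempty.\<close>
  obtain k where "k \<in> I" using assms(2) by blast
  then have "(\<lambda>i. if i = k then 1 else 0) \<in> S"
    using assms(1) by (auto simp: S_iff if_distrib[of "\<lambda>x. x\<^sup>2"] sum.delta cong: if_cong)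
  then have "S \<noteq> {}" by blast
  then obtain x where "x \<in> S" "\<forall>y\<in>S. q x \<le> q y"
    using continuous_attains_inf[OF \<open>compact S\<close>] continuous_on_subset[OF assms(3)] by blast
  then show thesis by (intro that[of x]) (auto simp: S_iff)
qed

text \<open>
  Let \<open>x\<close> minimize the quadratic form \<open>q\<close> on the unit sphere, with value \<open>\<mu>\<close>. By homogeneity
  \<open>q y - \<mu> \<bar>y\<bar>\<^sup>2 \<ge> 0\<close> for all \<open>y\<close>, with equality at \<open>x\<close>. Moving from \<open>x\<close> along the residual
  \<open>r = A x - \<mu> x\<close> changes this nonnegative expression at first order by \<open>2 t \<bar>r\<bar>\<^sup>2\<close>, by symmetry
  of \<open>A\<close>; therefore \<open>r = 0\<close>.
\<close>

lemma symmetric_eigenvector_minimizing_quadratic_form: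
  fixes A :: "'i \<Rightarrow> 'i \<Rightarrow> real"
  assumes fin: "finite I" and ne: "I \<noteq> {}"
    and sym: "\<And>i j. i \<in> I \<Longrightarrow> j \<in> I \<Longrightarrow> A i j = A j i"
  shows "\<exists>\<mu> x. (\<exists>k\<in>I. x k \<noteq> 0) \<and> (\<forall>i\<in>I. (\<Sum>j\<in>I. A i j * x j) = \<mu> * x i) \<and>
    (\<forall>y. \<mu> * (\<Sum>i\<in>I. (y i)\<^sup>2) \<le> (\<Sum>i\<in>I. \<Sum>j\<in>I. A i j * y i * y j))"
proof -
  define q where "q y = (\<Sum>i\<in>I. \<Sum>j\<in>I. A i j * y i * y j)" for y :: "'i \<Rightarrow> real"
  define N where "N y = (\<Sum>i\<in>I. (y i)\<^sup>2)" for y :: "'i \<Rightarrow> real"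
  have "continuous_on UNIV q"
    unfolding q_def by (intro continuous_intros continuous_on_product_coordinates)
  from exists_unit_minimizer[OF fin ne this] obtain x where x: "N x = 1"
    and min: "\<And>y. N y = 1 \<Longrightarrow> (\<And>i. i \<notin> I \<Longrightarrow> y i = 0) \<Longrightarrow> q x \<le> q y"
    unfolding N_def by metis
  define \<mu> where "\<mu> = q x"
  have bound: "\<mu> * N y \<le> q y" for y
  proof (cases "N y = 0")
    case True
    then have "\<forall>i\<in>I. y i = 0"
      using fin by (simp add: N_def sum_nonneg_eq_0_iff)
    then have "q y = 0" by (simp add: q_def)
    with True show ?thesis by simp
  next
    case False
    have "N y \<ge> 0" by (simp add: N_def sum_nonneg)
    with False have pos: "N y > 0" by simp
    define z where "z i = (if i \<in> I then y i / sqrt (N y) else 0)" for i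
    have "N z = (\<Sum>i\<in>I. (y i)\<^sup>2 / N y)"
      unfolding N_def[of z] using pos by (intro sum.cong) (auto simp: z_def power_divide)
    also have "\<dots> = 1"
      using False by (simp add: sum_divide_distrib[symmetric] N_def[symmetric])
    finally have Nz: "N z = 1" .
    have "q z = (\<Sum>i\<in>I. \<Sum>j\<in>I. A i j * y i * y j / N y)"
      unfolding q_def using pos by (intro sum.cong) (auto simp: z_def field_simps)
    also have "\<dots> = q y / N y" by (simp add: q_def sum_divide_distrib)
    finally have "q z = q y / N y" .
    with min[OF Nz] have "\<mu> \<le> q y / N y" by (simp add: z_def \<mu>_def)
    with pos show ?thesis by (simp add: field_simps)
  qed
  define r where "r i = (\<Sum>j\<in>I. A i j * x j) - \<mu> * x i" for i
  have swap: "(\<Sum>i\<in>I. \<Sum>j\<in>I. A i j * x i * r j) = (\<Sum>i\<in>I. \<Sum>j\<in>I. A i j * r i * x j)"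
    by (subst sum.swap) (auto intro!: sum.cong simp: sym)
  define u where "u = (\<Sum>i\<in>I. r i * (\<Sum>j\<in>I. A i j * x j))"
  define w where "w = (\<Sum>i\<in>I. r i * x i)"
  have "(r i)\<^sup>2 = r i * ((\<Sum>j\<in>I. A i j * x j) - \<mu> * x i)" for i
    by (simp add: r_def power2_eq_square)
  then have Nr: "N r = u - \<mu> * w"
    by (simp add: N_def u_def w_def right_diff_distrib sum_subtractf sum_distrib_left mult_ac)
  have "0 \<le> 2 * t * N r + t\<^sup>2 * (q r - \<mu> * N r)" for t
  proof -
    let ?y = "\<lambda>i. x i + t * r i"
    have "q ?y = q x + t * (\<Sum>i\<in>I. \<Sum>j\<in>I. A i j * x i * r j)
        + t * (\<Sum>i\<in>I. \<Sum>j\<in>I. A i j * r i * x j) + t\<^sup>2 * q r"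
      by (simp add: q_def sum_distrib_left sum.distrib[symmetric] algebra_simps power2_eq_square)
    also have "\<dots> = \<mu> + 2 * t * u + t\<^sup>2 * q r"
      unfolding swap \<mu>_def u_def by (simp add: sum_distrib_left mult_ac)
    finally have q: "q ?y = \<mu> + 2 * t * u + t\<^sup>2 * q r" .
    have N: "N ?y = 1 + 2 * t * w + t\<^sup>2 * N r"
      unfolding x[symmetric]
      by (simp add: N_def w_def sum_distrib_left sum.distrib[symmetric] algebra_simps power2_eq_square)
    have "q ?y - \<mu> * N ?y = 2 * t * (u - \<mu> * w) + t\<^sup>2 * (q r - \<mu> * N r)"
      unfolding q N by (simp add: algebra_simps)
    with bound[of ?y] show ?thesis by (simp add: Nr)
  qed
  then have "N r = 0" by (rule linear_coeff_eq_0_if_quadratic_nonneg)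
  then have "\<forall>i\<in>I. r i = 0" using fin by (simp add: N_def sum_nonneg_eq_0_iff)
  then have "\<forall>i\<in>I. (\<Sum>j\<in>I. A i j * x j) = \<mu> * x i" by (simp add: r_def)
  moreover have "\<exists>k\<in>I. x k \<noteq> 0"
  proof (rule ccontr)
    assume "\<not> ?thesis"
    then have "N x = 0" by (simp add: N_def)
    with x show False by simp
  qed
  moreover have "\<forall>y. \<mu> * (\<Sum>i\<in>I. (y i)\<^sup>2) \<le> (\<Sum>i\<in>I. \<Sum>j\<in>I. A i j * y i * y j)"
    using bound by (simp add: N_def q_def)
  ultimately show ?thesis by blast
qed

lemma eigenvalue_iff_coordinates:
  fixes M :: "real mat"
  assumes M: "M \<in> carrier_mat n n"
  shows "eigenvalue M \<mu> \<longleftrightarrow>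
    (\<exists>x. (\<exists>k<n. x k \<noteq> 0) \<and> (\<forall>i<n. (\<Sum>j<n. M $$ (i, j) * x j) = \<mu> * x i))"
    (is "_ \<longleftrightarrow> ?R")
proof
  assume "eigenvalue M \<mu>"
  then obtain v where v: "v \<in> carrier_vec n" "v \<noteq> 0\<^sub>v n" "M *\<^sub>v v = \<mu> \<cdot>\<^sub>v v"
    using M by (auto simp: eigenvalue_def eigenvector_def)
  have "\<exists>k<n. v $ k \<noteq> 0"
    using v(1,2) by auto
  moreover have "(\<Sum>j<n. M $$ (i, j) * v $ j) = \<mu> * v $ i" if "i < n" for i
    using arg_cong[OF v(3), of "\<lambda>w. w $ i"] that M v(1)
    by (simp add: scalar_prod_def lessThan_atLeast0)
  ultimately show ?R by blast
next
  assume ?R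
  then obtain x k where x: "k < n" "x k \<noteq> 0"
    "\<forall>i<n. (\<Sum>j<n. M $$ (i, j) * x j) = \<mu> * x i" by blast
  have "M *\<^sub>v vec n x = \<mu> \<cdot>\<^sub>v vec n x"
    using M x(3) by (intro eq_vecI) (auto simp: scalar_prod_def lessThan_atLeast0)
  moreover have "vec n x \<noteq> 0\<^sub>v n"
    using x(1,2) by (metis index_vec index_zero_vec(1))
  ultimately show "eigenvalue M \<mu>"
    using M unfolding eigenvalue_def eigenvector_def by (auto intro!: exI[of _ "vec n x"])
qed

lemma nth_eigenvalue_1_least:
  assumes M: "M \<in> carrier_mat n n" and ev: "eigenvalue M \<mu>"
  shows "eigenvalue M (nth_eigenvalue 1 M)" and "nth_eigenvalue 1 M \<le> \<mu>"
proof -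
  let ?es = "eigenvalues_sorted M"
  have mem: "\<mu> \<in> set ?es" using set_eigenvalues_sorted[OF M] ev by simp
  then have "?es \<noteq> []" by auto
  then have head: "nth_eigenvalue 1 M = hd ?es" by (simp add: nth_eigenvalue_def hd_conv_nth)
  with \<open>?es \<noteq> []\<close> show "eigenvalue M (nth_eigenvalue 1 M)"
    using set_eigenvalues_sorted[OF M] hd_in_set by fastforce
  have "sorted ?es" by (simp add: eigenvalues_sorted_def)
  with mem \<open>?es \<noteq> []\<close> show "nth_eigenvalue 1 M \<le> \<mu>"
    unfolding head by (cases ?es) auto
qed

lemma symmetric_least_eigenvalue:
  fixes M :: "real mat"
  assumes M: "M \<in> carrier_mat n n" and "0 < n"
    and sym: "\<And>i j. i < n \<Longrightarrow> j < n \<Longrightarrow> M $$ (i, j) = M $$ (j, i)"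
  shows "eigenvalue M (nth_eigenvalue 1 M)"
    and "nth_eigenvalue 1 M * (\<Sum>i<n. (y i)\<^sup>2) \<le> (\<Sum>i<n. \<Sum>j<n. M $$ (i, j) * y i * y j)"
proof -
  have "{..<n} \<noteq> {}" using \<open>0 < n\<close> by auto
  then obtain \<mu> x where x: "\<exists>k<n. x k \<noteq> 0" "\<forall>i<n. (\<Sum>j<n. M $$ (i, j) * x j) = \<mu> * x i"
    and min: "\<forall>y. \<mu> * (\<Sum>i<n. (y i)\<^sup>2) \<le> (\<Sum>i<n. \<Sum>j<n. M $$ (i, j) * y i * y j)"
    using symmetric_eigenvector_minimizing_quadratic_form[of "{..<n}" "\<lambda>i j. M $$ (i, j)"] sym
    unfolding Bex_def Ball_def lessThan_iff by blast
  have ev: "eigenvalue M \<mu>" using eigenvalue_iff_coordinates[OF M] x by blast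
  show "eigenvalue M (nth_eigenvalue 1 M)" by (rule nth_eigenvalue_1_least[OF M ev])
  have "nth_eigenvalue 1 M * (\<Sum>i<n. (y i)\<^sup>2) \<le> \<mu> * (\<Sum>i<n. (y i)\<^sup>2)"
    by (intro mult_right_mono nth_eigenvalue_1_least[OF M ev] sum_nonneg) simp
  also note min[rule_format]
  finally show "nth_eigenvalue 1 M * (\<Sum>i<n. (y i)\<^sup>2) \<le> (\<Sum>i<n. \<Sum>j<n. M $$ (i, j) * y i * y j)" .
qed

section \<open>Row sums and eigenvalues\<close>

text \<open>
  Let \<open>x\<close> be an eigenvector and \<open>i\<close> an index where \<open>\<bar>x i\<bar>\<close> is maximal. Multiplying row \<open>i\<close> of the
  eigenvalue equation by \<open>x i\<close> makes the argument independent of the sign of \<open>x i\<close>: since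
  \<open>x j * x i \<le> (x i)\<^sup>2\<close> and the off-diagonal entries are nonpositive, replacing \<open>x j\<close> by \<open>x i\<close>
  throughout the row bounds \<open>\<mu> (x i)\<^sup>2\<close> from below by the row sum times \<open>(x i)\<^sup>2\<close>.
\<close>

lemma eigenvalue_ge_some_row_sum:
  fixes M :: "real mat"
  assumes M: "M \<in> carrier_mat n n"
    and off: "\<And>i j. i < n \<Longrightarrow> j < n \<Longrightarrow> i \<noteq> j \<Longrightarrow> M $$ (i, j) \<le> 0"
    and ev: "eigenvalue M \<mu>"
  shows "\<exists>i<n. (\<Sum>j<n. M $$ (i, j)) \<le> \<mu>"
proof -
  obtain x k where k: "k < n" "x k \<noteq> 0"
    and eq: "\<And>i. i < n \<Longrightarrow> (\<Sum>j<n. M $$ (i, j) * x j) = \<mu> * x i"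
    using ev eigenvalue_iff_coordinates[OF M] by blast
  have "{..<n} \<noteq> {}" using k(1) by auto
  then obtain i where "i \<in> {..<n}" and "Max ((\<lambda>j. \<bar>x j\<bar>) ` {..<n}) = \<bar>x i\<bar>"
    using obtains_MAX[of "{..<n}" "\<lambda>j. \<bar>x j\<bar>"] by blast
  then have i: "i < n" and max: "\<And>j. j < n \<Longrightarrow> \<bar>x j\<bar> \<le> \<bar>x i\<bar>"
    by (auto simp flip: \<open>Max _ = _\<close>)
  have pos: "(x i)\<^sup>2 > 0" using max[OF k(1)] k(2) by auto
  have "(\<Sum>j<n. M $$ (i, j)) * (x i)\<^sup>2 = (\<Sum>j<n. M $$ (i, j) * (x i)\<^sup>2)"
    by (rule sum_distrib_right)
  also have "\<dots> \<le> (\<Sum>j<n. M $$ (i, j) * (x j * x i))"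
  proof (rule sum_mono)
    fix j assume "j \<in> {..<n}"
    then have j: "j < n" by simp
    have "x j * x i \<le> \<bar>x j\<bar> * \<bar>x i\<bar>" by (metis abs_ge_self abs_mult)
    also have "\<dots> \<le> \<bar>x i\<bar> * \<bar>x i\<bar>" using max[OF j] by (intro mult_right_mono) auto
    finally have "x j * x i \<le> (x i)\<^sup>2" by (simp add: power2_eq_square)
    then show "M $$ (i, j) * (x i)\<^sup>2 \<le> M $$ (i, j) * (x j * x i)"
      using off[OF i j] by (cases "i = j") (auto simp: power2_eq_square intro: mult_left_mono_neg)
  qed
  also have "\<dots> = (\<Sum>j<n. M $$ (i, j) * x j) * x i"
    by (simp add: sum_distrib_right mult.assoc)
  also have "\<dots> = \<mu> * (x i)\<^sup>2" using eq[OF i] by (simp add: power2_eq_square)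
  finally show ?thesis using pos i by auto
qed

section \<open>The transmission matrix of a graph\<close>

text \<open>The arcs leaving a vertex are determined by their heads, as there are no parallel arcs.\<close>

lemma (in digraph) out_degree_eq_card_neighbours:
  "out_degree G u = card {v \<in> verts G. u \<rightarrow>\<^bsub>G\<^esub> v}"
proof -
  have "inj_on (head G) (out_arcs G u)"
    by (rule inj_onI) (auto intro: no_multi_arcs simp: arc_to_ends_def)
  moreover have "head G ` out_arcs G u = {v \<in> verts G. u \<rightarrow>\<^bsub>G\<^esub> v}"
    by (force simp: arcs_ends_def arc_to_ends_def)
  ultimately show ?thesis unfolding out_degree_def by (metis card_image)
qed

lemma atrs_mat_row_sum:
  assumes "digraph G" and "distinct vs" and "set vs = verts G" and "i < length vs"
  shows "(\<Sum>j<length vs. atrs_mat G vs $$ (i, j))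
    = real (trs G (vs ! i)) - real (out_degree G (vs ! i))"
proof -
  interpret digraph G by fact
  let ?u = "vs ! i"
  have "(\<Sum>j<length vs. atrs_mat G vs $$ (i, j))
      = (\<Sum>j<length vs. (if j = i then real (trs G ?u) else 0) - (if ?u \<rightarrow>\<^bsub>G\<^esub> vs ! j then 1 else 0))"
    using assms(4) by (intro sum.cong) (auto simp: atrs_mat_def trs_mat_def adj_mat_def mat_diag_def)
  also have "\<dots> = real (trs G ?u) - (\<Sum>j<length vs. if ?u \<rightarrow>\<^bsub>G\<^esub> vs ! j then 1 else 0)"
    using assms(4) by (simp add: sum_subtractf)
  also have "(\<Sum>j<length vs. if ?u \<rightarrow>\<^bsub>G\<^esub> vs ! j then 1 else 0)
      = (\<Sum>v\<in>verts G. if ?u \<rightarrow>\<^bsub>G\<^esub> v then 1 else (0::real))"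
    using assms(2,3) by (intro sum.reindex_bij_betw bij_betw_nth) auto
  also have "\<dots> = real (out_degree G ?u)"
    by (simp add: out_degree_eq_card_neighbours sum.If_cases Int_def)
  finally show ?thesis .
qed

theorem theorem4p6:
  fixes G :: "('a, 'b) pre_digraph" and vs :: "'a list" and n :: nat
  assumes "graph G"
    and "Digraph_Component.connected G"
    and "n = card (verts G)"
    and "distinct vs" and "set vs = verts G"
  shows "Min ((\<lambda>u. real (trs G u) - real (out_degree G u)) ` verts G)
           \<le> nth_eigenvalue 1 (atrs_mat G vs)
       \<and> nth_eigenvalue 1 (atrs_mat G vs)
           \<le> 1 / real n * (\<Sum>u\<in>verts G. real (trs G u) - real (out_degree G u))"
proof -
  interpret graph G by fact
  let ?M = "atrs_mat G vs"
  let ?f = "\<lambda>u. real (trs G u) - real (out_degree G u)"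
  have n: "n = length vs" using assms(3-5) distinct_card by metis
  have M: "?M \<in> carrier_mat n n"
    unfolding atrs_mat_def adj_mat_def n by (intro minus_carrier_mat) simp
  have "verts G \<noteq> {}"
    using assms(2) by (auto simp: Digraph_Component.connected_def strongly_connected_def)
  then have "n > 0" using assms(3) by (simp add: card_gt_0_iff)
  have sym: "?M $$ (i, j) = ?M $$ (j, i)" if "i < n" "j < n" for i j
    using that arcs_ends_symmetric[OF sym_arcs]
    by (auto simp: atrs_mat_def trs_mat_def adj_mat_def mat_diag_def n)
  have off: "?M $$ (i, j) \<le> 0" if "i < n" "j < n" "i \<noteq> j" for i j
    using that by (simp add: atrs_mat_def trs_mat_def adj_mat_def mat_diag_def n)
  have row: "(\<Sum>j<n. ?M $$ (i, j)) = ?f (vs ! i)" if "i < n" for i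
    using atrs_mat_row_sum[OF digraph_axioms assms(4,5)] that by (simp add: n)
  have "(\<Sum>i<n. \<Sum>j<n. ?M $$ (i, j)) = (\<Sum>i<n. ?f (vs ! i))"
    by (simp add: row)
  also have "\<dots> = (\<Sum>u\<in>verts G. ?f u)"
    using assms(4,5) n by (intro sum.reindex_bij_betw bij_betw_nth) auto
  finally have total: "(\<Sum>i<n. \<Sum>j<n. ?M $$ (i, j)) = (\<Sum>u\<in>verts G. ?f u)" .
  note least = symmetric_least_eigenvalue[OF M \<open>n > 0\<close> sym]
  obtain i where i: "i < n" "(\<Sum>j<n. ?M $$ (i, j)) \<le> nth_eigenvalue 1 ?M"
    using eigenvalue_ge_some_row_sum[OF M off least(1)] by blast
  have "vs ! i \<in> verts G" using i(1) n assms(5) nth_mem by metis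
  then have "Min (?f ` verts G) \<le> ?f (vs ! i)" by (intro Min_le) auto
  also have "\<dots> \<le> nth_eigenvalue 1 ?M" using i row by simp
  finally have lower: "Min (?f ` verts G) \<le> nth_eigenvalue 1 ?M" .
  \<comment> \<open>The all-ones vector has quadratic form equal to the sum of all entries and squared norm \<open>n\<close>.\<close>
  have "nth_eigenvalue 1 ?M * real n \<le> (\<Sum>u\<in>verts G. ?f u)"
    using least(2)[of "\<lambda>_. 1"] by (simp add: total)
  then have "nth_eigenvalue 1 ?M \<le> 1 / real n * (\<Sum>u\<in>verts G. ?f u)"
    using \<open>n > 0\<close> by (simp add: field_simps)
  with lower show ?thesis by blast
qed

end
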